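(* Up to equivalence, the color adjacency matrices of the perfect 3-colorings of the Platonic graphs are exactly the following. Tetrahedral graph: $\begin{pmatrix}0&1&2\\1&0&2\\1&1&1\end{pmatrix}$. Cube graph: $\begin{pmatrix}0&1&2\\1&0&2\\1&1&1\end{pmatrix}$, $\begin{pmatrix}1&0&2\\0&1&2\\1&1&1\end{pmatrix}$. Octahedral graph: $\begin{pmatrix}0&0&4\\0&0&4\\1&1&2\end{pmatrix}$, $\begin{pmatrix}0&2&2\\2&0&2\\2&2&0\end{pmatrix}$, $\begin{pmatrix}0&2&2\\2&1&1\\2&1&1\end{pmatrix}$. Dodecahedral graph: $\begin{pmatrix}0&0&3\\0&0&3\\1&1&1\end{pmatrix}$, $\begin{pmatrix}0&3&0\\1&0&2\\0&1&2\end{pmatrix}$, $\begin{pmatrix}1&0&2\\0&1&2\\1&2&0\end{pmatrix}$. Icosahedral graph: $\begin{pmatrix}0&1&4\\1&0&4\\1&1&3\end{pmatrix}$, $\begin{pmatrix}0&2&3\\1&1&3\\1&2&2\end{pmatrix}$, $\begin{pmatrix}1&2&2\\2&1&2\\2&2&1\end{pmatrix}$. That is, for each of these graphs $G$, a $3\times 3$ matrix is the color adjacency matrix of some perfect 3-coloring of $G$ if and only if it is equivalent to one of the matrices listed for $G$.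
   Context: The Platonic graphs are the edge graphs (vertices and edges) of the five Platonic solids. An $m$-coloring of a graph $G=(V,E)$ is a partition of $V$ into $m$ disjoint nonempty sets $V_1,\ldots,V_m$ (the color classes; adjacent vertices may have the same color). The coloring is perfect if for all $i,j$ the number of neighbors of color $j$ of any vertex of color $i$ is a constant $a_{ij}$; the matrix $A=(a_{ij})_{1\le i,j\le m}$ is then called the color adjacency matrix of the perfect coloring. Two $m\times m$ matrices $A,B$ are equivalent (differ by a permutation of colors) if $B=PAP^{-1}$ for some permutation matrix $P$. *)

theory Defs
  imports "HOL-Analysis.Analysis"
begin

type_synonym 'a graph = "'a set \<times> 'a set set"

abbreviation verts :: "'a graph \<Rightarrow> 'a set" where "verts \<equiv> fst"
abbreviation edges :: "'a graph \<Rightarrow> 'a set set" where "edges \<equiv> snd"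

definition neighbors :: "'a graph \<Rightarrow> 'a \<Rightarrow> 'a set" where
  "neighbors G v = {w \<in> verts G. {v, w} \<in> edges G}"

text \<open>
  Here \<^const>\<open>edge_of\<close> requires affine dimension 1, so the end points of an edge are distinct.
\<close>

definition edge_graph :: "'a::euclidean_space set \<Rightarrow> 'a graph" where
  "edge_graph P = ({v. v extreme_point_of P}, {{u, v} | u v. closed_segment u v edge_of P})"

definition golden :: real where
  "golden = (1 + sqrt 5) / 2"

definition tetrahedron :: "(real^3) set" where
  "tetrahedron = convex hull
     {vector [1, 1, 1], vector [1, -1, -1], vector [-1, 1, -1], vector [-1, -1, 1]}"

definition cube :: "(real^3) set" where
  "cube = convex hull {vector [r, s, t] | r s t. {r, s, t} \<subseteq> {-1, 1}}"

definition octahedron :: "(real^3) set" where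
  "octahedron = convex hull
     ({vector [s, 0, 0] | s. s \<in> {-1, 1}} \<union>
      {vector [0, s, 0] | s. s \<in> {-1, 1}} \<union>
      {vector [0, 0, s] | s. s \<in> {-1, 1}})"

definition dodecahedron :: "(real^3) set" where
  "dodecahedron = convex hull
     ({vector [r, s, t] | r s t. {r, s, t} \<subseteq> {-1, 1}} \<union>
      {vector [0, s / golden, t * golden] | s t. {s, t} \<subseteq> {-1, 1}} \<union>
      {vector [s / golden, t * golden, 0] | s t. {s, t} \<subseteq> {-1, 1}} \<union>
      {vector [t * golden, 0, s / golden] | s t. {s, t} \<subseteq> {-1, 1}})"

definition icosahedron :: "(real^3) set" where
  "icosahedron = convex hull
     ({vector [0, s, t * golden] | s t. {s, t} \<subseteq> {-1, 1}} \<union>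
      {vector [s, t * golden, 0] | s t. {s, t} \<subseteq> {-1, 1}} \<union>
      {vector [t * golden, 0, s] | s t. {s, t} \<subseteq> {-1, 1}})"

text \<open>
  The colors are the elements of the finite index type \<open>'m\<close>, and \<open>C i\<close> is the class of color \<open>i\<close>.
\<close>

definition coloring :: "'a graph \<Rightarrow> ('m::finite \<Rightarrow> 'a set) \<Rightarrow> bool" where
  "coloring G C \<longleftrightarrow> (\<forall>i. C i \<noteq> {}) \<and> disjoint_family C \<and> (\<Union>i. C i) = verts G"

definition perfect_coloring :: "'a graph \<Rightarrow> ('m::finite \<Rightarrow> 'a set) \<Rightarrow> bool" where
  "perfect_coloring G C \<longleftrightarrow>
     coloring G C \<and> (\<forall>i j. \<exists>a. \<forall>v\<in>C i. card (neighbors G v \<inter> C j) = a)"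

definition is_color_adjacency_matrix ::
    "'a graph \<Rightarrow> ('m::finite \<Rightarrow> 'a set) \<Rightarrow> real^'m^'m \<Rightarrow> bool" where
  "is_color_adjacency_matrix G C A \<longleftrightarrow>
     perfect_coloring G C \<and> (\<forall>i j. \<forall>v\<in>C i. A $ i $ j = real (card (neighbors G v \<inter> C j)))"

definition permutation_matrix :: "real^'m^'m \<Rightarrow> bool" where
  "permutation_matrix P \<longleftrightarrow> (\<exists>p. p permutes UNIV \<and> P = (\<chi> i j. if j = p i then 1 else 0))"

definition equivalent_matrices :: "real^'m^'m \<Rightarrow> real^'m^'m \<Rightarrow> bool" where
  "equivalent_matrices A B \<longleftrightarrow> (\<exists>P. permutation_matrix P \<and> B = P ** A ** matrix_inv P)"

definition perfect_coloring_matrices :: "'a graph \<Rightarrow> (real^'m^'m) set" where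
  "perfect_coloring_matrices G = {A. \<exists>C. is_color_adjacency_matrix G C A}"

definition up_to_equivalence :: "(real^'m^'m) set \<Rightarrow> (real^'m^'m) set" where
  "up_to_equivalence \<A> = {B. \<exists>A\<in>\<A>. equivalent_matrices A B}"

abbreviation matrix3 :: "real list list \<Rightarrow> real^3^3" where
  "matrix3 rs \<equiv> vector (map vector rs)"

end

theory Submission
  imports Defs
begin

text \<open>
  The proof reduces the classification to two finite computations, one about the shape of each solid
  and one about its edge graph, which the simplifier carries out inside the logic.

  Shape. The vertices of each solid lie on a sphere, and a pair of vertices spans an edge exactly if
  it attains the largest inner product \<open>g\<close> between distinct vertices. For a pair with \<open>u \<bullet> v = g\<close> the
  functional \<open>u + v\<close> exposes the segment. Conversely, if \<open>v - u\<close> lies in the convex cone generated by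
  the vectors from \<open>u\<close> to its neighbors, then no functional can be maximal at both \<open>u\<close> and \<open>v\<close>
  without being maximal at a neighbor as well, so the segment is not a face
  (\<open>edge_graph_spherical_hull\<close>). The coordinates of all vertices are in the ring \<open>\<int>[\<phi>]\<close> of the
  golden ratio, where signs are decided by integer arithmetic, and membership in the cone is read off
  from the signs of the determinants in Cramer's rule (\<open>edge_certificate_sound\<close>).

  Coloring. Once the vertices are numbered, a perfect coloring is a list of colors in which the vertices
  of each color see the same number of neighbors of each color. These lists are found by
  backtracking: the vertices are colored one after another, and as soon as a vertex and all its
  neighbors are colored, the color counts at that vertex either fix a row of the matrix or must
  agree with the row that was fixed before. Renaming the colors, one may assume that they appear
  in the order 0, 1, 2 for the first time, which shrinks the search tree about sixfold. The search overlooks no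
  coloring (\<open>search_complete\<close>), every full table it returns is one of the listed matrices up to a
  renaming of the colors, and each listed matrix is realized by an explicit coloring
  (\<open>perfect_coloring_matrices_by_search\<close>).
\<close>

section \<open>Vertices and edges of a convex hull of points on a sphere\<close>

text \<open>
  A face of the convex hull of a finite set is the hull of those points of the set that it contains.
  The face cut out by the supporting hyperplane contains no point of \<open>S\<close> outside \<open>T\<close>.
\<close>

lemma convex_hull_exposed_subset_face:
  fixes S :: "'a::euclidean_space set"
  assumes "finite S" "T \<subseteq> S"
    and on: "\<And>x. x \<in> T \<Longrightarrow> c \<bullet> x = b" and below: "\<And>x. x \<in> S - T \<Longrightarrow> c \<bullet> x < b"
  shows "(convex hull T) face_of (convex hull S)"
proof -
  let ?F = "convex hull S \<inter> {x. c \<bullet> x = b}"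
  have "S \<subseteq> {x. c \<bullet> x \<le> b}"
    using on below by force
  then have "convex hull S \<subseteq> {x. c \<bullet> x \<le> b}"
    by (simp add: convex_halfspace_le subset_hull)
  then have F: "?F face_of (convex hull S)"
    by (intro face_of_Int_supporting_hyperplane_le) auto
  then obtain S' where S': "S' \<subseteq> S" "?F = convex hull S'"
    using face_of_convex_hull_subset[OF finite_imp_compact[OF \<open>finite S\<close>] F] by blast
  have "S' \<subseteq> T"
  proof
    fix x assume x: "x \<in> S'"
    then have "x \<in> ?F"
      using S'(2) hull_inc by metis
    then show "x \<in> T"
      using below[of x] S'(1) x by force
  qed
  then have "?F \<subseteq> convex hull T"
    using S'(2) hull_mono by metis
  moreover have "T \<subseteq> ?F"
    using on \<open>T \<subseteq> S\<close> hull_subset[of S convex] by auto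
  then have "convex hull T \<subseteq> ?F"
    by (intro hull_minimal convex_Int convex_hyperplane) auto
  ultimately show ?thesis
    using F by (simp add: subset_antisym)
qed

text \<open>
  An open halfspace together with its apex 0 is a convex cone; unlike the closed halfspace it still
  tells 0 apart from the other points of the cone.
\<close>

lemma convex_cone_hull_open_halfspace:
  assumes "\<And>x. x \<in> N \<Longrightarrow> c \<bullet> x < 0" "x \<in> convex_cone hull N"
  shows "x = 0 \<or> c \<bullet> x < 0"
proof -
  have "convex_cone {x. x = 0 \<or> c \<bullet> x < 0}"
    unfolding convex_cone_iff
    by (auto simp: inner_add_right mult_pos_neg mult_le_0_iff less_le)
  then have "convex_cone hull N \<subseteq> {x. x = 0 \<or> c \<bullet> x < 0}"
    by (intro hull_minimal) (use assms(1) in auto)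
  with assms(2) show ?thesis by blast
qed

text \<open>
  The hypothesis \<open>cone\<close> makes the simplex method work at \<open>u\<close>: a linear functional that is smaller at all
  neighbors of \<open>u\<close> than at \<open>u\<close> is then smaller at every other vertex too. It fails for general
  spherical polytopes, whose edges may have different lengths.
\<close>

theorem edge_graph_spherical_hull:
  fixes S :: "'a::euclidean_space set"
  assumes fin: "finite S"
    and sphere: "\<And>x. x \<in> S \<Longrightarrow> x \<bullet> x = r"
    and max: "\<And>x y. \<lbrakk>x \<in> S; y \<in> S; x \<noteq> y\<rbrakk> \<Longrightarrow> x \<bullet> y \<le> g" and "g < r"
    and cone: "\<And>u v. \<lbrakk>u \<in> S; v \<in> S; u \<noteq> v; u \<bullet> v \<noteq> g\<rbrakk>
      \<Longrightarrow> v - u \<in> convex_cone hull {w - u | w. w \<in> S \<and> u \<bullet> w = g}"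
  shows "edge_graph (convex hull S) = (S, {{u, v} | u v. u \<in> S \<and> v \<in> S \<and> u \<bullet> v = g})"
proof -
  have extr: "x extreme_point_of convex hull S \<longleftrightarrow> x \<in> S" for x
  proof
    assume x: "x \<in> S"
    \<comment> \<open>The tangent hyperplane of the sphere at \<open>x\<close> touches the hull in \<open>x\<close> only.\<close>
    have "(convex hull {x}) face_of (convex hull S)"
    proof (rule convex_hull_exposed_subset_face[where c = x and b = r])
      fix y assume "y \<in> S - {x}"
      then show "x \<bullet> y < r"
        using max[of x y] x \<open>g < r\<close> by auto
    qed (use fin x sphere in auto)
    then show "x extreme_point_of convex hull S"
      by (simp add: face_of_singleton)
  qed (rule extreme_point_of_convex_hull)
  have "closed_segment u v edge_of convex hull S" if uv: "u \<in> S" "v \<in> S" "u \<bullet> v = g" for u v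
  proof -
    have "u \<noteq> v" using uv sphere \<open>g < r\<close> by force
    \<comment> \<open>Any other vertex \<open>y\<close> has \<open>(u + v) \<bullet> y \<le> 2 * g < r + g\<close>.\<close>
    have "(convex hull {u, v}) face_of (convex hull S)"
    proof (rule convex_hull_exposed_subset_face[where c = "u + v" and b = "r + g"])
      fix y assume "y \<in> S - {u, v}"
      then show "(u + v) \<bullet> y < r + g"
        using max[of u y] max[of v y] uv \<open>g < r\<close> by (auto simp: inner_add_left)
    qed (use fin uv sphere in \<open>auto simp: inner_add_left inner_commute[of v u]\<close>)
    then show ?thesis
      using \<open>u \<noteq> v\<close> by (simp add: edge_of_def segment_convex_hull aff_dim_convex_hull)
  qed
  moreover have "u \<in> S \<and> v \<in> S \<and> u \<bullet> v = g" if "closed_segment u v edge_of convex hull S" for u v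
  proof -
    have face: "closed_segment u v face_of convex hull S" and dim: "aff_dim (closed_segment u v) = 1"
      using that by (auto simp: edge_of_def)
    have "u \<noteq> v" using dim by auto
    have uv: "u \<in> S" "v \<in> S"
      using extreme_point_of_face[OF face] extreme_point_of_segment[of _ u v] extr by blast+
    moreover have "u \<bullet> v = g"
    proof (rule ccontr)
      assume "u \<bullet> v \<noteq> g"
      then have in_cone: "v - u \<in> convex_cone hull {w - u | w. w \<in> S \<and> u \<bullet> w = g}"
        using cone uv \<open>u \<noteq> v\<close> by blast
      \<comment> \<open>Faces of a polyhedron are exposed, so a functional \<open>a\<close> is maximal exactly on the segment.\<close>
      have "polyhedron (convex hull S)"
        using fin by (intro polytope_imp_polyhedron) (auto simp: polytope_def)
      then have "closed_segment u v exposed_face_of convex hull S"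
        using face exposed_face_of_polyhedron by blast
      then obtain a b where ab: "convex hull S \<subseteq> {x. a \<bullet> x \<le> b}"
          "closed_segment u v = convex hull S \<inter> {x. a \<bullet> x = b}"
        by (auto simp: exposed_face_of_def)
      have u: "a \<bullet> u = b" and v: "a \<bullet> v = b"
        using ab(2) by auto
      have "a \<bullet> x < 0" if x: "x \<in> {w - u | w. w \<in> S \<and> u \<bullet> w = g}" for x
      proof -
        obtain w where w: "w \<in> S" "u \<bullet> w = g" "x = w - u"
          using x by blast
        have "w \<noteq> u" "w \<noteq> v"
          using w \<open>u \<bullet> v \<noteq> g\<close> sphere[of u] uv \<open>g < r\<close> by auto
        \<comment> \<open>The neighbor \<open>w\<close> is a vertex, so it could lie on the segment only as an end point.\<close>
        have "w \<notin> closed_segment u v"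
          using extreme_point_of_face[OF face] extreme_point_of_segment[of w u v] extr w \<open>w \<noteq> u\<close> \<open>w \<noteq> v\<close>
          by blast
        moreover have "w \<in> convex hull S" 
          using w by (simp add: hull_inc)
        ultimately have "a \<bullet> w < b"
          using ab by force
        then show ?thesis
          using u w by (simp add: inner_diff_right)
      qed
      then have "v - u = 0 \<or> a \<bullet> (v - u) < 0"
        using in_cone by (rule convex_cone_hull_open_halfspace)
      then show False
        using \<open>u \<noteq> v\<close> u v by (simp add: inner_diff_right)
    qed
    ultimately show ?thesis by blast
  qed
  ultimately have "(closed_segment u v edge_of convex hull S) \<longleftrightarrow> u \<in> S \<and> v \<in> S \<and> u \<bullet> v = g" for u v
    by blast
  then show ?thesis
    by (simp add: edge_graph_def extr)
qed

section \<open>Exact arithmetic with the golden ratio\<close>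

text \<open>The pair \<open>(a, b)\<close> stands for \<open>a + b * \<phi>\<close>, where \<open>\<phi>\<close> is the golden ratio.\<close>

type_synonym zphi = "int \<times> int"
type_synonym zvec = "zphi \<times> zphi \<times> zphi"

fun real_of_zphi :: "zphi \<Rightarrow> real" where
  "real_of_zphi (a, b) = of_int a + of_int b * golden"

fun zminus :: "zphi \<Rightarrow> zphi \<Rightarrow> zphi" where
  "zminus (a, b) (c, d) = (a - c, b - d)"

fun zplus :: "zphi \<Rightarrow> zphi \<Rightarrow> zphi" where
  "zplus (a, b) (c, d) = (a + c, b + d)"

fun ztimes :: "zphi \<Rightarrow> zphi \<Rightarrow> zphi" where
  "ztimes (a, b) (c, d) = (a * c + b * d, a * d + b * c + b * d)"

text \<open>
  Since \<open>2 * (a + b * \<phi>) = s + b * \<surd>5\<close> with \<open>s = 2 * a + b\<close>, the sign is that of the term of larger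
  absolute value, and comparing the squares of the two terms needs integers only.
\<close>

fun zpos :: "zphi \<Rightarrow> bool" where
  "zpos (a, b) \<longleftrightarrow> (let s = 2 * a + b in
     0 < s \<and> 5 * b\<^sup>2 < s\<^sup>2 \<or> 0 < b \<and> s\<^sup>2 < 5 * b\<^sup>2)"

lemma golden_square: "golden * golden = golden + 1"
  by (simp add: golden_def field_simps)

lemma real_of_zphi_arith:
  "real_of_zphi (zminus p q) = real_of_zphi p - real_of_zphi q"
  "real_of_zphi (zplus p q) = real_of_zphi p + real_of_zphi q"
  "real_of_zphi (ztimes p q) = real_of_zphi p * real_of_zphi q"
proof -
  obtain a b c d where [simp]: "p = (a, b)" "q = (c, d)"
    by (cases p, cases q)
  have "(of_int b * golden) * (of_int d * golden) = of_int b * of_int d * (golden + 1 :: real)"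
    by (simp flip: golden_square)
  then show "real_of_zphi (ztimes p q) = real_of_zphi p * real_of_zphi q"
    by (simp add: algebra_simps)
qed (cases p; cases q; simp add: algebra_simps)+

lemma real_of_zphi_pos:
  assumes "zpos p"
  shows "0 < real_of_zphi p"
proof -
  obtain a b where p: "p = (a, b)" by (cases p)
  define s where "s = 2 * a + b"
  have val: "2 * real_of_zphi p = of_int s + of_int b * sqrt 5"
    by (simp add: p s_def golden_def field_simps)
  have sq: "(of_int b * sqrt 5)\<^sup>2 = real_of_int (5 * b\<^sup>2)" 
    by (simp add: power_mult_distrib)
  consider "0 < s" "5 * b\<^sup>2 < s\<^sup>2" | "0 < b" "s\<^sup>2 < 5 * b\<^sup>2"
    using assms unfolding p zpos.simps s_def Let_def by blast
  then have "0 < of_int s + of_int b * sqrt 5"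
  proof cases
    case 1
    then have "(of_int b * sqrt 5)\<^sup>2 < (real_of_int s)\<^sup>2"
      unfolding sq by (metis of_int_less_iff of_int_power)
    then have "\<bar>of_int b * sqrt 5\<bar> < real_of_int s"
      using 1(1) by (metis abs_of_pos of_int_0_less_iff power2_abs power_less_imp_less_base
          less_imp_le)
    then show ?thesis by linarith
  next
    case 2
    then have "(real_of_int s)\<^sup>2 < (of_int b * sqrt 5)\<^sup>2"
      unfolding sq by (metis of_int_less_iff of_int_power)
    moreover have "0 \<le> of_int b * sqrt 5" using 2(1) by simp
    ultimately have "\<bar>real_of_int s\<bar> < of_int b * sqrt 5"
      by (metis power2_abs power_less_imp_less_base)
    then show ?thesis by linarith
  qed
  then show ?thesis using val by linarith
qed

fun point :: "zvec \<Rightarrow> real^3" where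
  "point (x, y, z) = vector [real_of_zphi x, real_of_zphi y, real_of_zphi z]"

fun zdiff :: "zvec \<Rightarrow> zvec \<Rightarrow> zvec" where
  "zdiff (x, y, z) (x', y', z') = (zminus x x', zminus y y', zminus z z')"

fun zdot :: "zvec \<Rightarrow> zvec \<Rightarrow> zphi" where
  "zdot (x, y, z) (x', y', z') = zplus (ztimes x x') (zplus (ztimes y y') (ztimes z z'))"

fun zcross :: "zvec \<Rightarrow> zvec \<Rightarrow> zvec" where
  "zcross (x, y, z) (x', y', z') =
     (zminus (ztimes y z') (ztimes z y'), zminus (ztimes z x') (ztimes x z'), zminus (ztimes x y') (ztimes y x'))"

lemma point_arith:
  "point (zdiff p q) = point p - point q"
  "real_of_zphi (zdot p q) = point p \<bullet> point q"
  "point (zcross p q) = cross3 (point p) (point q)"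
  by (cases p rule: prod_cases3; cases q rule: prod_cases3;
      simp add: real_of_zphi_arith cross3_def inner_vec_def sum_3 vec_eq_iff forall_3)+

lemma Cramer_vec3:
  fixes a b c d :: "real^3"
  shows "(a \<bullet> cross3 b c) *\<^sub>R d =
    (d \<bullet> cross3 b c) *\<^sub>R a + (a \<bullet> cross3 d c) *\<^sub>R b + (a \<bullet> cross3 b d) *\<^sub>R c"
  by (simp add: cross3_def inner_vec_def sum_3 vec_eq_iff forall_3 algebra_simps)

definition zdet :: "zvec \<Rightarrow> zvec \<Rightarrow> zvec \<Rightarrow> zphi" where
  "zdet a b c = zdot a (zcross b c)"

definition znonneg :: "zphi \<Rightarrow> bool" where
  "znonneg p \<longleftrightarrow> p = (0, 0) \<or> zpos p"

text \<open>
  By Cramer's rule the coefficients of \<open>d\<close> with respect to \<open>a\<close>, \<open>b\<close>, \<open>c\<close> are quotients of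
  determinants with denominator \<open>D\<close>. Multiplying by \<open>D * D\<close> instead of dividing by \<open>D\<close> makes the
  test independent of the orientation of \<open>a\<close>, \<open>b\<close>, \<open>c\<close> and keeps it in \<open>\<int>[\<phi>]\<close>; positivity of \<open>D * D\<close> says
  that the three vectors are linearly independent.
\<close>

definition spans_cone_around :: "zvec \<Rightarrow> zvec list \<Rightarrow> bool" where
  "spans_cone_around d ws \<longleftrightarrow> (case ws of [a, b, c] \<Rightarrow>
      (let D = zdet a b c in
       zpos (ztimes D D) \<and> znonneg (ztimes D (zdet d b c)) \<and>
       znonneg (ztimes D (zdet a d c)) \<and> znonneg (ztimes D (zdet a b d)))
    | _ \<Rightarrow> False)"

lemma spans_cone_around_sound:
  assumes "spans_cone_around d ws"
  shows "point d \<in> convex_cone hull (point ` set ws)"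
proof -
  obtain a b c where ws: "ws = [a, b, c]"
    using assms by (auto simp: spans_cone_around_def split: list.splits)
  define D where "D = real_of_zphi (zdet a b c)"
  have nonneg: "znonneg p \<Longrightarrow> 0 \<le> real_of_zphi p" for p
    using real_of_zphi_pos[of p] by (auto simp: znonneg_def)
  have D: "0 < D * D"
    and coeff: "0 \<le> D * real_of_zphi (zdet d b c)" "0 \<le> D * real_of_zphi (zdet a d c)"
      "0 \<le> D * real_of_zphi (zdet a b d)"
    using assms real_of_zphi_pos[of "ztimes (zdet a b c) (zdet a b c)"]
      nonneg[of "ztimes (zdet a b c) (zdet d b c)"] nonneg[of "ztimes (zdet a b c) (zdet a d c)"]
      nonneg[of "ztimes (zdet a b c) (zdet a b d)"]
    by (simp_all add: ws spans_cone_around_def Let_def real_of_zphi_arith D_def)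
  let ?K = "convex_cone hull (point ` set ws)"
  have in_K: "point a \<in> ?K" "point b \<in> ?K" "point c \<in> ?K"
    by (simp_all add: ws hull_inc)
  have "(D * D) *\<^sub>R point d = D *\<^sub>R (D *\<^sub>R point d)" by simp
  also have "D *\<^sub>R point d = real_of_zphi (zdet d b c) *\<^sub>R point a
      + real_of_zphi (zdet a d c) *\<^sub>R point b + real_of_zphi (zdet a b d) *\<^sub>R point c"
    unfolding D_def zdet_def point_arith by (rule Cramer_vec3)
  also have "D *\<^sub>R \<dots> = (D * real_of_zphi (zdet d b c)) *\<^sub>R point a
      + (D * real_of_zphi (zdet a d c)) *\<^sub>R point b + (D * real_of_zphi (zdet a b d)) *\<^sub>R point c"
    by (simp add: scaleR_right_distrib)
  also have "\<dots> \<in> ?K"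
    using coeff in_K by (intro convex_cone_hull_add convex_cone_hull_mul)
  finally have "(1 / (D * D)) *\<^sub>R (D * D) *\<^sub>R point d \<in> ?K"
    by (rule convex_cone_hull_mul) simp
  moreover have "D \<noteq> 0" using D by auto
  ultimately show ?thesis by simp
qed

definition neighbor_list :: "zphi \<Rightarrow> zvec list \<Rightarrow> zvec \<Rightarrow> zvec list" where
  "neighbor_list g ps p = filter (\<lambda>q. zdot p q = g) ps"

text \<open>
  Caratheodory's theorem is the reason why it suffices to look for cones over three neighbors,
  also at the vertices of the octahedron and the icosahedron, which have four and five.
\<close>

definition edge_certificate :: "zphi \<Rightarrow> zphi \<Rightarrow> zvec list \<Rightarrow> bool" where
  "edge_certificate r g ps \<longleftrightarrow> distinct ps \<and> zpos (zminus r g) \<and>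
     list_all (\<lambda>p. zdot p p = r \<and>
       list_all (\<lambda>q. p = q \<or> zdot p q = g \<or>
         zpos (zminus g (zdot p q)) \<and>
         list_ex (spans_cone_around (zdiff q p))
           (filter (\<lambda>ws. length ws = 3)
              (subseqs (map (\<lambda>w. zdiff w p) (neighbor_list g ps p))))) ps) ps"

lemma edge_certificate_sound:
  assumes cert: "edge_certificate r g ps"
  shows "inj_on point (set ps)"
    and "edge_graph (convex hull (point ` set ps)) = (point ` set ps,
      {{point p, point q} | p q. p \<in> set ps \<and> q \<in> set ps \<and> zdot p q = g})" 
    and "\<lbrakk>p \<in> set ps; q \<in> set ps\<rbrakk> \<Longrightarrow> point p \<bullet> point q = real_of_zphi g \<longleftrightarrow> zdot p q = g"
proof -
  let ?S = "point ` set ps" and ?g = "real_of_zphi g" and ?r = "real_of_zphi r"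
  have gr: "?g < ?r"
    using cert real_of_zphi_pos[of "zminus r g"] by (simp add: edge_certificate_def real_of_zphi_arith)
  have self: "point p \<bullet> point p = ?r" if "p \<in> set ps" for p
    using cert that by (simp add: edge_certificate_def list_all_iff flip: point_arith)
  have far: "point p \<bullet> point q < ?g" 
    and cone: "point q - point p \<in> convex_cone hull {w - point p | w. w \<in> ?S \<and> point p \<bullet> w = ?g}"
    if pq: "p \<in> set ps" "q \<in> set ps" "p \<noteq> q" "zdot p q \<noteq> g" for p q
  proof -
    obtain ws where ws: "ws \<in> set (subseqs (map (\<lambda>w. zdiff w p) (neighbor_list g ps p)))"
        "spans_cone_around (zdiff q p) ws" and pos: "zpos (zminus g (zdot p q))"
      using cert pq unfolding edge_certificate_def list_all_iff list_ex_iff by fastforce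
    show "point p \<bullet> point q < ?g"
      using real_of_zphi_pos[OF pos] by (simp add: real_of_zphi_arith point_arith)
    have "set ws \<subseteq> (\<lambda>w. zdiff w p) ` set (neighbor_list g ps p)"
      using ws(1) by (metis PowD image_eqI list.set_map subseqs_powset)
    moreover have "point (zdiff w p) \<in> {w - point p | w. w \<in> ?S \<and> point p \<bullet> w = ?g}"
      if "w \<in> set (neighbor_list g ps p)" for w
      using that point_arith(2)[of p w] by (auto simp: neighbor_list_def point_arith(1))
    ultimately have "point ` set ws \<subseteq> {w - point p | w. w \<in> ?S \<and> point p \<bullet> w = ?g}"
      by blast
    then show "point q - point p \<in> convex_cone hull {w - point p | w. w \<in> ?S \<and> point p \<bullet> w = ?g}"
      using spans_cone_around_sound[OF ws(2)] unfolding point_arith(1) by (meson hull_mono subsetD)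
  qed
  show dot: "point p \<bullet> point q = ?g \<longleftrightarrow> zdot p q = g" if "p \<in> set ps" "q \<in> set ps" for p q
    using far[OF that] self[OF that(1)] gr point_arith(2)[of p q] by fastforce
  show inj: "inj_on point (set ps)"
  proof (rule inj_onI)
    fix p q assume pq: "p \<in> set ps" "q \<in> set ps" "point p = point q"
    then have "point p \<bullet> point q = ?r" using self by metis
    then show "p = q"
      using far[OF pq(1,2)] dot[OF pq(1,2)] gr by force
  qed
  have "edge_graph (convex hull ?S) = (?S, {{u, v} | u v. u \<in> ?S \<and> v \<in> ?S \<and> u \<bullet> v = ?g})"
  proof (rule edge_graph_spherical_hull[where r = ?r])
    fix x y assume "x \<in> ?S" "y \<in> ?S" "x \<noteq> y"
    then obtain p q where "p \<in> set ps" "q \<in> set ps" "p \<noteq> q" "x = point p" "y = point q"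
      by blast
    then show "x \<bullet> y \<le> ?g"
      using far[of p q] dot[of p q] by fastforce
  next
    fix u v assume "u \<in> ?S" "v \<in> ?S" "u \<noteq> v" "u \<bullet> v \<noteq> ?g"
    then obtain p q where "p \<in> set ps" "q \<in> set ps" "p \<noteq> q" "u = point p" "v = point q"
        "zdot p q \<noteq> g"
      using dot by blast
    then show "v - u \<in> convex_cone hull {w - u | w. w \<in> ?S \<and> u \<bullet> w = ?g}"
      using cone[of p q] by simp
  qed (use gr self in auto)
  also have "{{u, v} | u v. u \<in> ?S \<and> v \<in> ?S \<and> u \<bullet> v = ?g} =
      {{point p, point q} | p q. p \<in> set ps \<and> q \<in> set ps \<and> zdot p q = g}"
    using dot by blast
  finally show "edge_graph (convex hull ?S) =
    (?S, {{point p, point q} | p q. p \<in> set ps \<and> q \<in> set ps \<and> zdot p q = g})" .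
qed

section \<open>Colorings of a graph with numbered vertices\<close>

text \<open>The map \<open>p\<close> numbers the vertices, and \<open>N ! k\<close> lists the numbers of the neighbors of vertex \<open>k\<close>.\<close>

definition graph_listing :: "'a graph \<Rightarrow> (nat \<Rightarrow> 'a) \<Rightarrow> nat list list \<Rightarrow> bool" where
  "graph_listing G p N \<longleftrightarrow> inj_on p {..<length N} \<and> verts G = p ` {..<length N} \<and>
     (\<forall>k<length N. distinct (N ! k) \<and> set (N ! k) \<subseteq> {..<length N} \<and>
        neighbors G (p k) = p ` set (N ! k))"

lemma graph_listing_less:
  "\<lbrakk>graph_listing G p N; k < length N; l \<in> set (N ! k)\<rbrakk> \<Longrightarrow> l < length N"
  by (auto simp: graph_listing_def)

definition adjacency_lists :: "zphi \<Rightarrow> zvec list \<Rightarrow> nat list list" where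
  "adjacency_lists g ps = map (\<lambda>p. filter (\<lambda>j. zdot p (ps ! j) = g) [0..<length ps]) ps"

lemma edge_certificate_graph_listing:
  assumes "edge_certificate r g ps"
  shows "graph_listing (edge_graph (convex hull (point ` set ps))) (\<lambda>k. point (ps ! k))
    (adjacency_lists g ps)"
proof -
  let ?n = "length ps" and ?p = "\<lambda>k. point (ps ! k)"
  let ?G = "edge_graph (convex hull (point ` set ps))"
  note G = edge_certificate_sound(2)[OF assms]
  have dist: "distinct ps" using assms by (simp add: edge_certificate_def)
  have inj: "inj_on ?p {..<?n}"
  proof (rule inj_onI)
    fix k l assume "k \<in> {..<?n}" "l \<in> {..<?n}" "?p k = ?p l"
    then show "k = l"
      using inj_onD[OF edge_certificate_sound(1)[OF assms], of "ps ! k" "ps ! l"]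
        nth_eq_iff_index_eq[OF dist] by simp
  qed
  have set_ps: "set ps = (!) ps ` {..<?n}"
    by (auto simp: set_conv_nth)
  have verts: "verts ?G = ?p ` {..<?n}"
    unfolding G by (simp add: set_ps image_image)
  have sym: "zdot p q = g \<longleftrightarrow> zdot q p = g" if "p \<in> set ps" "q \<in> set ps" for p q
    using edge_certificate_sound(3)[OF assms] that by (metis inner_commute)
  have "neighbors ?G (?p k) = ?p ` set (adjacency_lists g ps ! k)" if k: "k < ?n" for k
  proof -
    have "{?p k, ?p l} \<in> edges ?G \<longleftrightarrow> zdot (ps ! k) (ps ! l) = g" if l: "l < ?n" for l
    proof -
      have "{?p k, ?p l} \<in> edges ?G \<longleftrightarrow> (\<exists>p\<in>set ps. \<exists>q\<in>set ps. zdot p q = g \<and>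
          (?p k = point p \<and> ?p l = point q \<or> ?p k = point q \<and> ?p l = point p))"
        unfolding G snd_conv mem_Collect_eq doubleton_eq_iff by blast
      also have "\<dots> \<longleftrightarrow> (\<exists>p\<in>set ps. \<exists>q\<in>set ps. zdot p q = g \<and>
          (p = ps ! k \<and> q = ps ! l \<or> p = ps ! l \<and> q = ps ! k))"
        using inj_on_eq_iff[OF edge_certificate_sound(1)[OF assms]] nth_mem[OF k] nth_mem[OF l] by metis
      also have "\<dots> \<longleftrightarrow> zdot (ps ! k) (ps ! l) = g"
        using sym nth_mem[OF k] nth_mem[OF l] by blast
      finally show ?thesis .
    qed
    then show ?thesis
      using k by (auto simp: neighbors_def verts adjacency_lists_def)
  qed
  then show ?thesis
    using inj verts by (auto simp: graph_listing_def adjacency_lists_def)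
qed

text \<open>
  A coloring is a family of disjoint classes, or equivalently a map \<open>c\<close> from vertex numbers to
  colors; the latter form is the one on which a search can operate.
\<close>

lemma perfect_coloring_matrices_listing:
  fixes A :: "real^'m::finite^'m"
  assumes "graph_listing G p N"
  shows "A \<in> perfect_coloring_matrices G \<longleftrightarrow> (\<exists>c. c ` {..<length N} = UNIV \<and>
    (\<forall>k<length N. \<forall>j. A $ c k $ j = real (length (filter (\<lambda>l. c l = j) (N ! k)))))"
proof -
  let ?n = "length N"
  have inj: "inj_on p {..<?n}" and verts: "verts G = p ` {..<?n}"
    and N: "\<And>k. k < ?n \<Longrightarrow> distinct (N ! k)" "\<And>k. k < ?n \<Longrightarrow> set (N ! k) \<subseteq> {..<?n}"
      "\<And>k. k < ?n \<Longrightarrow> neighbors G (p k) = p ` set (N ! k)"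
    using assms by (auto simp: graph_listing_def)
  have card_class: "card (neighbors G (p k) \<inter> C j) = length (filter (\<lambda>l. c l = j) (N ! k))"
    if C: "\<And>l i. l < ?n \<Longrightarrow> p l \<in> C i \<longleftrightarrow> c l = i" and k: "k < ?n" for C :: "'m \<Rightarrow> 'a set" and c k j
  proof -
    have "neighbors G (p k) \<inter> C j = p ` set (filter (\<lambda>l. c l = j) (N ! k))"
      using C N(2)[OF k] N(3)[OF k] by auto
    moreover have "inj_on p (set (filter (\<lambda>l. c l = j) (N ! k)))"
      using inj by (rule inj_on_subset) (use N(2)[OF k] in auto)
    ultimately have "card (neighbors G (p k) \<inter> C j) = card (set (filter (\<lambda>l. c l = j) (N ! k)))"
      by (simp add: card_image)
    then show ?thesis
      using N(1)[OF k] by (simp add: distinct_card del: set_filter)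
  qed
  show ?thesis
  proof
    assume "A \<in> perfect_coloring_matrices G"
    then obtain C where C: "coloring G C"
      and A: "\<And>i j v. v \<in> C i \<Longrightarrow> A $ i $ j = real (card (neighbors G v \<inter> C j))"
      by (auto simp: perfect_coloring_matrices_def is_color_adjacency_matrix_def perfect_coloring_def)
    have "\<exists>!i. p l \<in> C i" if "l < ?n" for l
    proof -
      have "p l \<in> (\<Union>i. C i)" using C that by (auto simp: coloring_def verts)
      then show ?thesis
        using C by (fastforce simp: coloring_def disjoint_family_on_def)
    qed
    then obtain c where c: "\<And>l i. l < ?n \<Longrightarrow> p l \<in> C i \<longleftrightarrow> c l = i"
      by metis
    have "i \<in> c ` {..<?n}" for i
    proof -
      have "C i \<noteq> {}" using C by (simp add: coloring_def)
      then obtain v where "v \<in> C i" by blast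
      moreover then have "v \<in> p ` {..<?n}" using C by (auto simp: coloring_def verts)
      ultimately show ?thesis using c by auto
    qed
    moreover have "A $ c k $ j = real (length (filter (\<lambda>l. c l = j) (N ! k)))" if "k < ?n" for k j
      using A[of "p k" "c k" j] card_class[of C c k j] c that by simp
    ultimately show "\<exists>c. c ` {..<?n} = UNIV \<and>
        (\<forall>k<?n. \<forall>j. A $ c k $ j = real (length (filter (\<lambda>l. c l = j) (N ! k))))"
      by blast
  next
    assume "\<exists>c. c ` {..<?n} = UNIV \<and>
        (\<forall>k<?n. \<forall>j. A $ c k $ j = real (length (filter (\<lambda>l. c l = j) (N ! k))))"
    then obtain c where surj: "c ` {..<?n} = UNIV"
      and A: "\<And>k j. k < ?n \<Longrightarrow> A $ c k $ j = real (length (filter (\<lambda>l. c l = j) (N ! k)))"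
      by blast
    define C where "C i = p ` {l. l < ?n \<and> c l = i}" for i
    have C: "p l \<in> C i \<longleftrightarrow> c l = i" if "l < ?n" for l i
      using that inj by (auto simp: C_def inj_on_def)
    have "coloring G C"
      unfolding coloring_def disjoint_family_on_def
    proof (intro conjI allI ballI impI)
      fix i show "C i \<noteq> {}" using surj by (auto simp: C_def) (metis UNIV_I imageE lessThan_iff)
    next
      fix i j :: 'm assume "i \<noteq> j"
      then show "C i \<inter> C j = {}" using C by (auto simp: C_def)
    qed (auto simp: C_def verts)
    moreover have "A $ i $ j = real (card (neighbors G v \<inter> C j))" if v: "v \<in> C i" for i j v
    proof -
      obtain k where "k < ?n" "c k = i" "v = p k" using v by (auto simp: C_def)
      then show ?thesis using A card_class[of C c k j] C by auto
    qed
    ultimately have "is_color_adjacency_matrix G C A"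
      unfolding is_color_adjacency_matrix_def perfect_coloring_def
      by (metis of_nat_eq_iff)
    then show "A \<in> perfect_coloring_matrices G"
      by (auto simp: perfect_coloring_matrices_def)
  qed
qed

section \<open>Matrices up to renaming of the colors\<close>

text \<open>Conjugation by a permutation matrix, whose inverse is its transpose, renames rows and columns.\<close>

lemma equivalent_matrices_iff:
  fixes A B :: "real^'m::finite^'m"
  shows "equivalent_matrices A B \<longleftrightarrow> (\<exists>p. bij p \<and> (\<forall>i j. B $ i $ j = A $ p i $ p j))"
proof -
  have conj: "P ** A ** matrix_inv P = (\<chi> i j. A $ p i $ p j)"
    if p: "bij p" and P: "P = (\<chi> i j. if j = p i then 1 else 0)" for p and P :: "real^'m^'m"
  proof -
    have entry: "P $ i $ j = (if j = p i then 1 else 0)" for i j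
      by (simp add: P)
    have left: "(P ** X) $ i $ j = X $ p i $ j" for X :: "real^'m^'m" and i j
      by (simp add: entry matrix_matrix_mult_def if_distrib[of "\<lambda>x. x * _"] cong: if_cong)
    have right: "(X ** transpose P) $ i $ j = X $ i $ p j" for X :: "real^'m^'m" and i j
      by (simp add: entry matrix_matrix_mult_def transpose_def if_distrib[of "\<lambda>x. _ * x"] cong: if_cong)
    have "P ** transpose P = mat 1"
      using p by (auto simp: vec_eq_iff left transpose_def mat_def entry bij_def inj_def)
    moreover then have "transpose P ** P = mat 1"
      using matrix_left_right_inverse by blast
    ultimately have inv: "P ** matrix_inv P = mat 1 \<and> matrix_inv P ** P = mat 1"
      unfolding matrix_inv_def by (rule_tac someI2[of _ "transpose P"]) auto
    have "matrix_inv P = transpose P ** P ** matrix_inv P"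
      using \<open>transpose P ** P = mat 1\<close> by simp
    also have "\<dots> = transpose P"
      using inv by (simp flip: matrix_mul_assoc)
    finally have "matrix_inv P = transpose P" .
    then show ?thesis
      unfolding vec_eq_iff \<open>matrix_inv P = transpose P\<close> by (simp add: right left)
  qed
  show ?thesis
  proof
    assume "equivalent_matrices A B"
    then obtain p P where "p permutes UNIV" "P = (\<chi> i j. if j = p i then 1 else 0)" "B = P ** A ** matrix_inv P"
      by (auto simp: equivalent_matrices_def permutation_matrix_def)
    with conj show "\<exists>p. bij p \<and> (\<forall>i j. B $ i $ j = A $ p i $ p j)"
      by (intro exI[of _ p]) (auto simp: permutes_bij)
  next
    assume "\<exists>p. bij p \<and> (\<forall>i j. B $ i $ j = A $ p i $ p j)"
    then obtain p where p: "bij p" "B = (\<chi> i j. A $ p i $ p j)"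
      by (auto simp: vec_eq_iff)
    define P :: "real^'m^'m" where "P = (\<chi> i j. if j = p i then 1 else 0)"
    have "permutation_matrix P"
      unfolding permutation_matrix_def using bij_imp_permutes[OF p(1)] P_def by blast
    then show "equivalent_matrices A B"
      using conj[OF p(1) P_def] p(2) by (auto simp: equivalent_matrices_def)
  qed
qed

text \<open>
  The bijection \<open>f\<close> is an arbitrary numbering of the three indices, so \<open>has_rows A M\<close> leaves \<open>A\<close>
  free up to equivalence.
\<close>

definition has_rows :: "real^3^3 \<Rightarrow> nat list list \<Rightarrow> bool" where
  "has_rows A M \<longleftrightarrow> (\<exists>f. bij_betw f UNIV {0, 1, 2} \<and> (\<forall>i j. A $ i $ j = real (M ! f i ! f j)))"

lemma bij_betw_numbering:
  fixes a b :: 3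
  assumes "a \<noteq> b"
  defines "f \<equiv> \<lambda>i. if i = a then 0 else if i = b then 1 else 2 :: nat"
  shows "bij_betw f UNIV {0, 1, 2}"
proof -
  have "card (UNIV - {a, b}) = 1"
    using assms(1) by (simp add: card_Diff_subset)
  then obtain d where d: "UNIV - {a, b} = {d}"
    by (rule card_1_singletonE)
  then have "UNIV = {a, b, d}" "d \<noteq> a" "d \<noteq> b"
    by auto
  moreover have "bij_betw f {a, b, d} {0, 1, 2}" if "d \<noteq> a" "d \<noteq> b"
    using that assms(1) by (auto simp: bij_betw_def f_def)
  ultimately show ?thesis by simp
qed

lemma up_to_equivalence_matrix3:
  assumes "length M = 3" "\<forall>r\<in>set M. length r = 3"
  shows "up_to_equivalence {matrix3 (map (map real) M)} = {A. has_rows A M}"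
proof -
  define f0 :: "3 \<Rightarrow> nat" where "f0 i = (if i = 1 then 0 else if i = 2 then 1 else 2)" for i
  have f0: "bij_betw f0 UNIV {0, 1, 2}"
    unfolding f0_def by (rule bij_betw_numbering) simp
  obtain r0 r1 r2 where M: "M = [r0, r1, r2]"
    using assms(1) by (auto simp: numeral_3_eq_3 length_Suc_conv)
  obtain a b c where r0: "r0 = [a, b, c]"
    using assms(2) M by (auto simp: numeral_3_eq_3 length_Suc_conv)
  obtain a' b' c' where r1: "r1 = [a', b', c']"
    using assms(2) M by (auto simp: numeral_3_eq_3 length_Suc_conv)
  obtain a'' b'' c'' where r2: "r2 = [a'', b'', c'']"
    using assms(2) M by (auto simp: numeral_3_eq_3 length_Suc_conv)
  have entry: "matrix3 (map (map real) M) $ i $ j = real (M ! f0 i ! f0 j)" for i j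
    using exhaust_3[of i] exhaust_3[of j] by (auto simp: M r0 r1 r2 f0_def)
  show ?thesis
  proof (intro set_eqI iffI)
    fix B assume "B \<in> up_to_equivalence {matrix3 (map (map real) M)}"
    then obtain p where p: "bij p" "\<And>i j. B $ i $ j = real (M ! f0 (p i) ! f0 (p j))"
      by (auto simp: up_to_equivalence_def equivalent_matrices_iff entry simp del: map_map)
    moreover have "bij_betw (f0 \<circ> p) UNIV {0, 1, 2}"
      using p(1) f0 by (rule bij_betw_trans)
    ultimately show "B \<in> {A. has_rows A M}"
      unfolding has_rows_def by auto
  next
    fix B assume "B \<in> {A. has_rows A M}"
    then obtain f where f: "bij_betw f UNIV {0, 1, 2}" "\<And>i j. B $ i $ j = real (M ! f i ! f j)"
      unfolding has_rows_def by auto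
    let ?p = "inv_into UNIV f0 \<circ> f"
    have "bij ?p"
      using f(1) bij_betw_inv_into[OF f0] by (rule bij_betw_trans)
    moreover have "f0 (?p i) = f i" for i
      using f0 f(1) by (simp add: bij_betw_def) (metis f_inv_into_f rangeI)
    ultimately show "B \<in> up_to_equivalence {matrix3 (map (map real) M)}"
      using f(2) by (auto simp: up_to_equivalence_def equivalent_matrices_iff entry simp del: map_map)
  qed
qed

definition permuted_rows :: "nat list \<Rightarrow> nat list list \<Rightarrow> nat list list" where
  "permuted_rows q M = map (\<lambda>i. map (\<lambda>j. M ! i ! j) q) q"

lemma has_rows_permuted:
  assumes "has_rows A (permuted_rows q M)" "length q = 3" "set q = {0, 1, 2}"
  shows "has_rows A M"
proof -
  obtain f where f: "bij_betw f UNIV {0, 1, 2}"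
      "\<And>i j. A $ i $ j = real (permuted_rows q M ! f i ! f j)"
    using assms(1) unfolding has_rows_def by auto
  have less: "f i < length q" for i
    using bspec[OF bij_betwE[OF f(1)], of i] assms(2) by auto
  have "bij_betw ((!) q) {..<length q} (set q)"
    using assms by (intro bij_betw_nth) (auto simp: card_distinct)
  moreover have "{..<length q} = {0, 1, 2}"
    using assms(2) by auto
  ultimately have "bij_betw ((!) q \<circ> f) UNIV {0, 1, 2}"
    using f(1) assms(3) bij_betw_trans by metis
  moreover have "A $ i $ j = real (M ! (((!) q \<circ> f) i) ! (((!) q \<circ> f) j))" for i j
    using f(2) less by (simp add: permuted_rows_def)
  ultimately show ?thesis
    unfolding has_rows_def by blast
qed

section \<open>Colorings as lists\<close>

definition counts :: "nat list \<Rightarrow> nat list" where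
  "counts xs = map (\<lambda>j. length (filter (\<lambda>x. x = j) xs)) [0, 1, 2]"

lemma counts_nth: "j \<in> {0, 1, 2} \<Longrightarrow> counts xs ! j = length (filter (\<lambda>x. x = j) xs)"
  by (auto simp: counts_def)

lemma length_counts [simp]: "length (counts xs) = 3"
  by (simp add: counts_def)

text \<open>
  The entry \<open>cs ! v\<close> is the color of vertex \<open>v\<close>, and row \<open>i\<close> of \<open>M\<close> lists the numbers of neighbors of
  the colors 0, 1, 2 that a vertex of color \<open>i\<close> has.
\<close>

definition perfect_list :: "nat list list \<Rightarrow> nat list list \<Rightarrow> nat list \<Rightarrow> bool" where
  "perfect_list N M cs \<longleftrightarrow> length cs = length N \<and> length M = 3 \<and> set cs = {0, 1, 2} \<and>
     list_all (\<lambda>v. M ! (cs ! v) = counts (map ((!) cs) (N ! v))) [0..<length N]"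

lemma perfect_list_rows:
  assumes "perfect_list N M cs"
  shows "length M = 3" "\<forall>r\<in>set M. length r = 3"
proof -
  show 3: "length M = 3" using assms by (simp add: perfect_list_def)
  have "length (M ! i) = 3" if "i < 3" for i
  proof -
    have "i \<in> set cs" using assms that by (auto simp: perfect_list_def)
    then obtain v where "v < length N" "cs ! v = i"
      using assms by (auto simp: perfect_list_def in_set_conv_nth)
    then have "M ! i = counts (map ((!) cs) (N ! v))"
      using assms by (auto simp: perfect_list_def list_all_iff)
    then show ?thesis by simp
  qed
  then show "\<forall>r\<in>set M. length r = 3"
    using 3 by (auto simp: in_set_conv_nth)
qed

lemma perfect_list_matrix:
  assumes "graph_listing G p N" "perfect_list N M cs" "has_rows A M"
  shows "A \<in> perfect_coloring_matrices G"
proof -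
  let ?n = "length N"
  obtain f where f: "bij_betw f UNIV {0, 1, 2}" "\<And>i j. A $ i $ j = real (M ! f i ! f j)"
    using assms(3) unfolding has_rows_def by auto
  define c where "c l = inv_into UNIV f (cs ! l)" for l
  have cs: "length cs = ?n" "set cs = {0, 1, 2}"
    using assms(2) by (auto simp: perfect_list_def)
  have fc: "f (c l) = cs ! l" if "l < ?n" for l
    using f(1) cs that nth_mem[of l cs] unfolding c_def bij_betw_def by (metis f_inv_into_f)
  have inj: "f i = f j \<longleftrightarrow> i = j" for i j
    using f(1) by (auto simp: bij_betw_def inj_def)
  have "i \<in> c ` {..<?n}" for i
  proof -
    have "f i \<in> set cs" using bij_betwE[OF f(1)] cs by simp
    then obtain l where l: "l < ?n" "cs ! l = f i" using cs by (metis in_set_conv_nth)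
    have "c l = i" using fc[OF l(1)] l(2) inj[of "c l" i] by simp
    then show ?thesis using l by blast
  qed
  moreover have "A $ c k $ j = real (length (filter (\<lambda>l. c l = j) (N ! k)))" if k: "k < ?n" for k j
  proof -
    have "M ! (cs ! k) = counts (map ((!) cs) (N ! k))"
      using assms(2) k by (auto simp: perfect_list_def list_all_iff)
    then have "A $ c k $ j = real (counts (map ((!) cs) (N ! k)) ! f j)"
      using f(2) fc[OF k] by simp
    also have "counts (map ((!) cs) (N ! k)) ! f j = length (filter (\<lambda>l. cs ! l = f j) (N ! k))"
      using bspec[OF bij_betwE[OF f(1)], of j] by (simp add: counts_nth filter_map comp_def)
    also have "filter (\<lambda>l. cs ! l = f j) (N ! k) = filter (\<lambda>l. c l = j) (N ! k)"
    proof (rule filter_cong[OF refl])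
      fix l assume "l \<in> set (N ! k)"
      then have "l < ?n" by (rule graph_listing_less[OF assms(1) k])
      then show "cs ! l = f j \<longleftrightarrow> c l = j" using fc inj by metis
    qed
    finally show ?thesis .
  qed
  ultimately show ?thesis
    using perfect_coloring_matrices_listing[OF assms(1)] by blast
qed

text \<open>
  The colors allowed for the next vertex when colors must appear in the order 0, 1, 2 for the
  first time.
\<close>

definition choices :: "nat list \<Rightarrow> nat list" where
  "choices cs = (if cs = [] then [0] else if list_all (\<lambda>x. x = 0) cs then [0, 1] else [0, 1, 2])"

text \<open>
  The numbering of the colors is chosen so that vertex 0 gets color 0 and the first vertex of another
  color gets color 1; this is the normal form that the search runs through.
\<close>

lemma coloring_matrix_perfect_list:
  assumes "graph_listing G p N" "A \<in> perfect_coloring_matrices G"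
  obtains M cs where "perfect_list N M cs" "has_rows A M"
    "\<And>k. k < length cs \<Longrightarrow> cs ! k \<in> set (choices (take k cs))"
proof -
  let ?n = "length N"
  obtain c where surj: "c ` {..<?n} = UNIV"
    and "\<forall>k<?n. \<forall>j. A $ c k $ j = real (length (filter (\<lambda>l. c l = j) (N ! k)))"
    using iffD1[OF perfect_coloring_matrices_listing[OF assms(1)] assms(2)] by (elim exE conjE)
  then have A: "A $ c k $ j = real (length (filter (\<lambda>l. c l = j) (N ! k)))" if "k < ?n" for k j
    using that by simp
  define a where "a = c 0"
  define m where "m = (LEAST m. c m \<noteq> a)"
  have "(1::3) \<noteq> 2" by simp
  then obtain x :: 3 where "x \<noteq> a" by metis
  then obtain l where "c l \<noteq> a" using surj by (metis UNIV_I imageE)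
  then have m: "c m \<noteq> a" and before_m: "\<And>k. k < m \<Longrightarrow> c k = a"
    unfolding m_def by (rule LeastI, blast dest: not_less_Least)
  define f :: "3 \<Rightarrow> nat" where "f i = (if i = a then 0 else if i = c m then 1 else 2)" for i
  have f: "bij_betw f UNIV {0, 1, 2}"
    unfolding f_def using m by (intro bij_betw_numbering) simp
  have inj: "f i = f j \<longleftrightarrow> i = j" for i j
    using f by (auto simp: bij_betw_def inj_def)
  have f_mem: "f i \<in> {0, 1, 2}" for i
    by (simp add: f_def)
  define cs where "cs = map (\<lambda>l. f (c l)) [0..<?n]"
  \<comment> \<open>The entries of \<open>A\<close> count neighbors, so taking the floor does not change them.\<close>
  define M where "M = map (\<lambda>i. map (\<lambda>j. nat \<lfloor>A $ inv_into UNIV f i $ inv_into UNIV f j\<rfloor>) [0, 1, 2]) [0, 1, 2::nat]"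
  have inv_f: "inv_into UNIV f (f i) = i" for i
    using f by (simp add: bij_betw_def)
  have M_nth: "M ! f i = map (\<lambda>j. nat \<lfloor>A $ i $ inv_into UNIV f j\<rfloor>) [0, 1, 2]" for i
    using f_mem[of i] inv_f[of i] by (auto simp: M_def)
  have M_entry: "M ! f i ! f j = nat \<lfloor>A $ i $ j\<rfloor>" for i j
    using f_mem[of j] inv_f[of j] by (auto simp: M_nth)
  have "A $ i $ j = real (M ! f i ! f j)" for i j
  proof -
    obtain k where "k < ?n" "c k = i" using surj by (metis UNIV_I imageE lessThan_iff)
    then show ?thesis using A[of k j] by (simp add: M_entry)
  qed
  then have "has_rows A M"
    unfolding has_rows_def using f by blast
  moreover have "perfect_list N M cs"
  proof -
    have "set cs = f ` c ` {..<?n}"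
      by (auto simp: cs_def)
    then have "set cs = {0, 1, 2}"
      using surj f by (simp add: bij_betw_def)
    moreover have "M ! (cs ! k) = counts (map ((!) cs) (N ! k))" if k: "k < ?n" for k
    proof -
      have map_cs: "map ((!) cs) (N ! k) = map (\<lambda>l. f (c l)) (N ! k)"
        using graph_listing_less[OF assms(1) k] by (simp add: cs_def)
      have "nat \<lfloor>A $ c k $ inv_into UNIV f j\<rfloor> = length (filter (\<lambda>l. f (c l) = j) (N ! k))"
        if "j \<in> {0, 1, 2}" for j
      proof -
        have "j \<in> range f" using bij_betw_imp_surj_on[OF f] that by simp
        then obtain i where i: "j = f i" by blast
        show ?thesis using A[OF k, of i] by (simp add: i inv_f inj)
      qed
      then have "M ! f (c k) = counts (map (\<lambda>l. f (c l)) (N ! k))"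
        by (simp add: M_nth counts_def filter_map comp_def)
      then show ?thesis
        using k by (simp add: map_cs) (simp add: cs_def)
    qed
    moreover have "length cs = ?n" "length M = 3"
      by (simp_all add: cs_def M_def)
    ultimately show ?thesis
      unfolding perfect_list_def list_all_iff by simp
  qed
  moreover have "cs ! k \<in> set (choices (take k cs))" if "k < length cs" for k
  proof -
    have k: "k < ?n" "cs ! k = f (c k)" using that by (simp_all add: cs_def)
    show ?thesis
    proof (cases "list_all (\<lambda>x. x = 0) (take k cs)")
      case True
      have "k \<le> m"
      proof (rule ccontr)
        assume "\<not> k \<le> m"
        then have "take k cs ! m = f (c m)" "m < length (take k cs)" using k by (auto simp: cs_def)
        moreover have "\<forall>i<length (take k cs). take k cs ! i = 0"
          using True by (simp only: list_all_length)
        ultimately have "f (c m) = 0" by metis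
        then show False using m by (simp add: f_def)
      qed
      then have "k = 0 \<and> c k = a \<or> k \<noteq> 0 \<and> (c k = a \<or> c k = c m)"
        using before_m[of k] a_def by (cases "k = m") auto
      then show ?thesis
        using k m that True by (auto simp: choices_def f_def a_def)
    next
      case False
      then show ?thesis using f_mem[of "c k"] k by (auto simp: choices_def)
    qed
  qed
  ultimately show ?thesis using that by blast
qed

section \<open>Backtracking search for perfect colorings\<close>

text \<open>
  The search interprets a program. \<open>Assign\<close> colors the next vertex in every admissible way, and
  \<open>Check v ns\<close> compares the color counts of the neighbors \<open>ns\<close> of \<open>v\<close> with the row of the color of
  \<open>v\<close>. The table \<open>T\<close> holds the rows known so far, with \<open>None\<close> for a color that has not been checked yet.
\<close>

datatype step = Assign | Check nat "nat list"

fun search :: "step list \<Rightarrow> nat list \<Rightarrow> nat list option list \<Rightarrow> nat list option list list" where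
  "search [] cs T = [T]"
| "search (Assign # ps) cs T = concat (map (\<lambda>x. search ps (cs @ [x]) T) (choices cs))"
| "search (Check v ns # ps) cs T = (case T ! (cs ! v) of
     None \<Rightarrow> search ps cs (T[cs ! v := Some (counts (map ((!) cs) ns))])
   | Some r \<Rightarrow> if r = counts (map ((!) cs) ns) then search ps cs T else [])"

text \<open>This guarantees that a check never reads a color that has not been assigned yet.\<close>

fun ready :: "nat \<Rightarrow> nat \<Rightarrow> step list \<Rightarrow> bool" where
  "ready n k [] \<longleftrightarrow> True"
| "ready n k (Assign # ps) \<longleftrightarrow> k < n \<and> ready n (Suc k) ps"
| "ready n k (Check v ns # ps) \<longleftrightarrow> v < k \<and> (\<forall>l\<in>set ns. l < k) \<and> ready n k ps"

definition compatible :: "nat list list \<Rightarrow> nat list option list \<Rightarrow> bool" where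
  "compatible M T \<longleftrightarrow> length T = 3 \<and> (\<forall>i<3. T ! i = None \<or> T ! i = Some (M ! i))"

text \<open>
  Following the choices made by \<open>cs\<close>, the search never fails a check. That the final table has an entry
  for each checked color shows later that it determines all of \<open>M\<close>.
\<close>

lemma search_complete:
  assumes "ready (length cs) k ps" "k \<le> length cs" "set cs \<subseteq> {0, 1, 2}"
    and "\<And>k. k < length cs \<Longrightarrow> cs ! k \<in> set (choices (take k cs))"
    and "\<And>v ns. Check v ns \<in> set ps \<Longrightarrow> M ! (cs ! v) = counts (map ((!) cs) ns)"
    and "compatible M T"
  shows "\<exists>T'\<in>set (search ps (take k cs) T). compatible M T' \<and>
     (\<forall>i<3. T ! i \<noteq> None \<longrightarrow> T' ! i \<noteq> None) \<and>
     (\<forall>v ns. Check v ns \<in> set ps \<longrightarrow> T' ! (cs ! v) \<noteq> None)"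
  using assms
proof (induction ps arbitrary: k T)
  case (Cons s ps)
  show ?case
  proof (cases s)
    case Assign
    then have k: "k < length cs" and ready: "ready (length cs) (Suc k) ps" 
      using Cons.prems by auto
    have "\<exists>T'\<in>set (search ps (take (Suc k) cs) T). compatible M T' \<and>
       (\<forall>i<3. T ! i \<noteq> None \<longrightarrow> T' ! i \<noteq> None) \<and>
       (\<forall>v ns. Check v ns \<in> set ps \<longrightarrow> T' ! (cs ! v) \<noteq> None)"
      using Cons.prems k by (intro Cons.IH ready) auto
    moreover have "take (Suc k) cs = take k cs @ [cs ! k]"
      using k by (rule take_Suc_conv_app_nth)
    moreover have "set (search ps (take k cs @ [cs ! k]) T) \<subseteq> set (search (s # ps) (take k cs) T)"
      using Cons.prems(4)[OF k] Assign by auto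
    ultimately show ?thesis
      using Assign by (metis (no_types, lifting) set_ConsD step.distinct(1) subsetD)
  next
    case (Check v ns)
    have ready: "v < k" "\<forall>l\<in>set ns. l < k" "ready (length cs) k ps"
      using Cons.prems(1) Check by auto
    let ?r = "counts (map ((!) cs) ns)"
    have "map ((!) (take k cs)) ns = map ((!) cs) ns" "take k cs ! v = cs ! v"
      using ready by auto
    note take_simps = this
    have "v < length cs" using ready Cons.prems(2) by simp
    then have "cs ! v \<in> {0, 1, 2}" using Cons.prems(3) nth_mem by blast
    then have cv: "cs ! v < 3" by auto
    have row: "M ! (cs ! v) = ?r" using Cons.prems(5)[of v ns] Check by simp
    define T1 where "T1 = T[cs ! v := Some ?r]"
    have T: "length T = 3" "T ! (cs ! v) = None \<or> T ! (cs ! v) = Some ?r"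
      using Cons.prems(6) cv row by (auto simp: compatible_def)
    have search: "search (s # ps) (take k cs) T = search ps (take k cs) T1"
    proof (cases "T ! (cs ! v)")
      case (Some r)
      then have "T1 = T" "r = ?r" using T by (auto simp: T1_def) (metis list_update_id)
      then show ?thesis by (simp add: Check Some take_simps del: map_eq_conv)
    qed (simp add: Check take_simps T1_def del: map_eq_conv)
    have T1: "compatible M T1"
      using Cons.prems(6) row T(1) cv by (auto simp: compatible_def T1_def nth_list_update)
    have "\<exists>T'\<in>set (search ps (take k cs) T1). compatible M T' \<and>
       (\<forall>i<3. T1 ! i \<noteq> None \<longrightarrow> T' ! i \<noteq> None) \<and>
       (\<forall>v ns. Check v ns \<in> set ps \<longrightarrow> T' ! (cs ! v) \<noteq> None)"
      using Cons.prems T1 ready by (intro Cons.IH) auto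
    then obtain T' where T': "T' \<in> set (search ps (take k cs) T1)" "compatible M T'"
       "\<And>i. i < 3 \<Longrightarrow> T1 ! i \<noteq> None \<Longrightarrow> T' ! i \<noteq> None"
       "\<And>v ns. Check v ns \<in> set ps \<Longrightarrow> T' ! (cs ! v) \<noteq> None"
      by blast
    have "T' ! i \<noteq> None" if "i < 3" "T ! i \<noteq> None \<or> i = cs ! v" for i
      using T'(3)[OF that(1)] that T(1) cv by (auto simp: T1_def nth_list_update)
    then show ?thesis
      using T' cv unfolding search by (intro bexI[of _ T']) (auto simp: Check)
  qed
qed simp

text \<open>
  Each vertex is checked right after the last member of its closed neighborhood has been colored, that
  is, as early as possible.
\<close>

definition completion_step :: "nat list list \<Rightarrow> nat \<Rightarrow> nat" where
  "completion_step N v = Max (set (v # N ! v))"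

definition program :: "nat list list \<Rightarrow> step list" where
  "program N = concat (map (\<lambda>k. Assign # map (\<lambda>v. Check v (N ! v))
     (filter (\<lambda>v. completion_step N v = k) [0..<length N])) [0..<length N])"

lemma ready_program: "ready (length N) 0 (program N)"
proof -
  have checks: "ready n k (map (\<lambda>v. Check v (N ! v)) vs @ ps) \<longleftrightarrow>
      (\<forall>v\<in>set vs. v < k \<and> (\<forall>l\<in>set (N ! v). l < k)) \<and> ready n k ps" for n k vs ps
    by (induction vs) auto
  have less: "l < Suc (completion_step N v)" if "l = v \<or> l \<in> set (N ! v)" for l v
    using that by (auto simp: completion_step_def less_Suc_eq_le intro: Max_ge)
  have "ready (length N) k (concat (map (\<lambda>k. Assign # map (\<lambda>v. Check v (N ! v))
     (filter (\<lambda>v. completion_step N v = k) [0..<length N])) [k..<length N]))" if "k \<le> length N" for k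
    using that
  proof (induction rule: inc_induct)
    case (step k)
    then show ?case
      by (auto simp: upt_conv_Cons checks less)
  qed simp
  from this[of 0] show ?thesis by (simp add: program_def)
qed

lemma Check_program:
  assumes "\<forall>ns\<in>set N. \<forall>l\<in>set ns. l < length N"
  shows "Check v ns \<in> set (program N) \<longleftrightarrow> v < length N \<and> ns = N ! v"
proof -
  have "completion_step N v < length N" if "v < length N"
    using assms that nth_mem[OF that] by (auto simp: completion_step_def)
  then show ?thesis
    by (auto simp: program_def)
qed

text \<open>Tables with a missing row come from colorings that use fewer than three colors.\<close>

definition listed_up_to_renaming :: "nat list list list \<Rightarrow> nat list option list \<Rightarrow> bool" where
  "listed_up_to_renaming Ms T \<longleftrightarrow> None \<in> set T \<or>
     list_ex (\<lambda>M. list_ex (\<lambda>q. T = map Some (permuted_rows q M))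
       [[0, 1, 2], [0, 2, 1], [1, 0, 2], [1, 2, 0], [2, 0, 1], [2, 1, 0]]) Ms"

theorem perfect_coloring_matrices_by_search:
  assumes cert: "edge_certificate r g ps" and N: "adjacency_lists g ps = N"
    and found: "list_all (listed_up_to_renaming Ms) (search (program N) [] [None, None, None])"
    and colorings: "list_all2 (perfect_list N) Ms Cs"
  shows "perfect_coloring_matrices (edge_graph (convex hull (point ` set ps))) =
    up_to_equivalence (set (map (\<lambda>M. matrix3 (map (map real) M)) Ms))"
proof -
  let ?G = "edge_graph (convex hull (point ` set ps))"
  have listing: "graph_listing ?G (\<lambda>k. point (ps ! k)) N"
    using edge_certificate_graph_listing[OF cert] N by simp
  have Ms: "\<exists>cs. perfect_list N M cs" if "M \<in> set Ms" for M
    using colorings that by (metis list_all2_conv_all_nth in_set_conv_nth)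
  have "up_to_equivalence (set (map (\<lambda>M. matrix3 (map (map real) M)) Ms)) =
      (\<Union>M\<in>set Ms. up_to_equivalence {matrix3 (map (map real) M)})"
    by (auto simp: up_to_equivalence_def)
  also have "\<dots> = {A. \<exists>M\<in>set Ms. has_rows A M}"
    using Ms perfect_list_rows up_to_equivalence_matrix3 by fastforce
  also have "\<dots> = perfect_coloring_matrices ?G"
  proof (intro set_eqI iffI; clarify)
    fix A M assume "M \<in> set Ms" "has_rows A M"
    then show "A \<in> perfect_coloring_matrices ?G"
      using Ms perfect_list_matrix[OF listing] by blast
  next
    fix A :: "real^3^3" assume "A \<in> perfect_coloring_matrices ?G"
    then obtain M cs where cs: "perfect_list N M cs" and A: "has_rows A M"
      and choices: "\<And>k. k < length cs \<Longrightarrow> cs ! k \<in> set (choices (take k cs))"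
      using coloring_matrix_perfect_list[OF listing] by blast
    have Check: "Check v ns \<in> set (program N) \<longleftrightarrow> v < length N \<and> ns = N ! v" for v ns
      using listing by (intro Check_program) (metis graph_listing_less in_set_conv_nth)
    have len: "length cs = length N" "set cs = {0, 1, 2}" "length M = 3"
      using cs by (auto simp: perfect_list_def)
    define T0 :: "nat list option list" where "T0 = [None, None, None]"
    have "\<exists>T'\<in>set (search (program N) (take 0 cs) T0). compatible M T' \<and>
       (\<forall>i<3. T0 ! i \<noteq> None \<longrightarrow> T' ! i \<noteq> None) \<and>
       (\<forall>v ns. Check v ns \<in> set (program N) \<longrightarrow> T' ! (cs ! v) \<noteq> None)"
    proof (rule search_complete)
      show "M ! (cs ! v) = counts (map ((!) cs) ns)" if "Check v ns \<in> set (program N)" for v ns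
        using that cs by (simp add: Check perfect_list_def list_all_iff)
      show "compatible M T0"
        by (auto simp: compatible_def T0_def nth_Cons split: nat.splits)
    qed (use choices len ready_program[of N] in auto)
    then obtain T where T: "T \<in> set (search (program N) [] [None, None, None])" "compatible M T"
        "\<And>v. v < length N \<Longrightarrow> T ! (cs ! v) \<noteq> None"
      unfolding T0_def by (auto simp: Check)
    have "T ! i = Some (M ! i)" if i: "i < 3" for i
    proof -
      have "i \<in> set cs" using i len by auto
      then obtain v where "v < length N" "cs ! v = i" using len by (metis in_set_conv_nth)
      then have "T ! i \<noteq> None" using T(3) by blast
      then show ?thesis using T(2) i by (auto simp: compatible_def)
    qed
    then have T_eq: "T = map Some M"
      using T(2) len by (intro nth_equalityI) (auto simp: compatible_def)
    have "listed_up_to_renaming Ms T"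
      using found T(1) by (simp add: list_all_iff)
    then obtain M' q where "M' \<in> set Ms" "length q = 3" "set q = {0, 1, 2}"
        "map Some M = map Some (permuted_rows q M')"
      by (auto simp: listed_up_to_renaming_def T_eq list_ex_iff; force)
    moreover then have "M = permuted_rows q M'"
      by (metis inj_Some inj_map_eq_map)
    ultimately show "\<exists>M\<in>set Ms. has_rows A M"
      using A has_rows_permuted by blast
  qed
  finally show ?thesis ..
qed
section \<open>The five solids\<close>

lemma inverse_golden: "1 / golden = golden - 1"
proof -
  have "golden \<noteq> 0" using golden_square by auto
  then show ?thesis using golden_square by (simp add: field_simps)
qed

lemma two_signs:
  "{f s t | s t. {s, t} \<subseteq> {-1, 1::real}} = {f 1 1, f 1 (-1), f (-1) 1, f (-1) (-1)}"
  by auto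

lemma three_signs:
  "{f r s t | r s t. {r, s, t} \<subseteq> {-1, 1::real}} =
    {f 1 1 1, f 1 1 (-1), f 1 (-1) 1, f 1 (-1) (-1), f (-1) 1 1, f (-1) 1 (-1), f (-1) (-1) 1, f (-1) (-1) (-1)}"
  by auto

lemma one_sign: "{f s | s. s \<in> {-1, 1::real}} = {f 1, f (-1)}"
  by auto

text \<open>
  Each new vertex in these lists is a neighbor of an earlier vertex whose neighborhood is as close to
  completion as possible; checks then occur early, which keeps the search tree small.
\<close>

definition tetrahedron_points :: "zvec list" where
  "tetrahedron_points =
    [((1, 0), (1, 0), (1, 0)), ((1, 0), (-1, 0), (-1, 0)), ((-1, 0), (1, 0), (-1, 0)),
     ((-1, 0), (-1, 0), (1, 0))]"

definition cube_points :: "zvec list" where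
  "cube_points =
    [((-1, 0), (-1, 0), (-1, 0)), ((-1, 0), (-1, 0), (1, 0)), ((-1, 0), (1, 0), (-1, 0)),
     ((1, 0), (-1, 0), (-1, 0)), ((-1, 0), (1, 0), (1, 0)), ((1, 0), (-1, 0), (1, 0)),
     ((1, 0), (1, 0), (-1, 0)), ((1, 0), (1, 0), (1, 0))]"

definition octahedron_points :: "zvec list" where
  "octahedron_points =
    [((-1, 0), (0, 0), (0, 0)), ((0, 0), (-1, 0), (0, 0)), ((0, 0), (1, 0), (0, 0)),
     ((0, 0), (0, 0), (-1, 0)), ((0, 0), (0, 0), (1, 0)), ((1, 0), (0, 0), (0, 0))]"

definition dodecahedron_points :: "zvec list" where
  "dodecahedron_points =
    [((-1, 0), (-1, 0), (-1, 0)), ((0, 0), (1, -1), (0, -1)), ((1, -1), (0, -1), (0, 0)),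
     ((0, -1), (0, 0), (1, -1)), ((1, 0), (-1, 0), (-1, 0)), ((0, 0), (-1, 1), (0, -1)),
     ((-1, 0), (-1, 0), (1, 0)), ((-1, 1), (0, -1), (0, 0)), ((0, 1), (0, 0), (1, -1)),
     ((1, 0), (-1, 0), (1, 0)), ((-1, 0), (1, 0), (-1, 0)), ((0, -1), (0, 0), (-1, 1)),
     ((1, 0), (1, 0), (-1, 0)), ((0, 0), (1, -1), (0, 1)), ((0, 1), (0, 0), (-1, 1)),
     ((1, -1), (0, 1), (0, 0)), ((-1, 0), (1, 0), (1, 0)), ((-1, 1), (0, 1), (0, 0)),
     ((0, 0), (-1, 1), (0, 1)), ((1, 0), (1, 0), (1, 0))]"

definition icosahedron_points :: "zvec list" where
  "icosahedron_points =
    [((0, 0), (-1, 0), (0, -1)), ((0, 0), (1, 0), (0, -1)), ((-1, 0), (0, -1), (0, 0)),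
     ((1, 0), (0, -1), (0, 0)), ((0, -1), (0, 0), (-1, 0)), ((0, 1), (0, 0), (-1, 0)),
     ((-1, 0), (0, 1), (0, 0)), ((1, 0), (0, 1), (0, 0)), ((0, -1), (0, 0), (1, 0)),
     ((0, 0), (-1, 0), (0, 1)), ((0, 1), (0, 0), (1, 0)), ((0, 0), (1, 0), (0, 1))]"

lemma tetrahedron_hull: "tetrahedron = convex hull (point ` set tetrahedron_points)"
  unfolding tetrahedron_def tetrahedron_points_def
  by (simp add: insert_commute)

lemma cube_hull: "cube = convex hull (point ` set cube_points)"
  unfolding cube_def cube_points_def three_signs
  by (rule arg_cong[of _ _ "\<lambda>S. convex hull S"]) auto

lemma octahedron_hull: "octahedron = convex hull (point ` set octahedron_points)"
  unfolding octahedron_def octahedron_points_def one_sign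
  by (rule arg_cong[of _ _ "\<lambda>S. convex hull S"]) auto

lemma dodecahedron_hull: "dodecahedron = convex hull (point ` set dodecahedron_points)"
  unfolding dodecahedron_def dodecahedron_points_def two_signs three_signs
  by (rule arg_cong[of _ _ "\<lambda>S. convex hull S"]) (auto simp: inverse_golden)

lemma icosahedron_hull: "icosahedron = convex hull (point ` set icosahedron_points)"
  unfolding icosahedron_def icosahedron_points_def two_signs
  by (rule arg_cong[of _ _ "\<lambda>S. convex hull S"]) auto

text \<open>
  In each of the following proofs the first computation determines the edges of the solid, the second
  one its adjacency lists, the third one runs the search, and the last one verifies a coloring for
  each listed matrix.
\<close>

lemma tetrahedron_matrices:
  "perfect_coloring_matrices (edge_graph tetrahedron) = up_to_equivalence
     (set (map (\<lambda>M. matrix3 (map (map real) M))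
       [[[0, 1, 2], [1, 0, 2], [1, 1, 1]]]))"
  unfolding tetrahedron_hull
proof (rule perfect_coloring_matrices_by_search)
  let ?N = "[[1, 2, 3], [0, 2, 3], [0, 1, 3], [0, 1, 2]]"
  show "edge_certificate (3, 0) (-1, 0) tetrahedron_points"
    unfolding tetrahedron_points_def by code_simp
  show "adjacency_lists (-1, 0) tetrahedron_points = ?N"
    unfolding tetrahedron_points_def by code_simp
  show "list_all (listed_up_to_renaming
      [[[0, 1, 2], [1, 0, 2], [1, 1, 1]]])
    (search (program ?N) [] [None, None, None])"
    by code_simp
  show "list_all2 (perfect_list ?N)
    [[[0, 1, 2], [1, 0, 2], [1, 1, 1]]]
    [[0, 1, 2, 2]]"
    by code_simp
qed

lemma cube_matrices:
  "perfect_coloring_matrices (edge_graph cube) = up_to_equivalence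
     (set (map (\<lambda>M. matrix3 (map (map real) M))
       [[[0, 1, 2], [1, 0, 2], [1, 1, 1]],
        [[1, 0, 2], [0, 1, 2], [1, 1, 1]]]))"
  unfolding cube_hull
proof (rule perfect_coloring_matrices_by_search)
  let ?N = "[[1, 2, 3], [0, 4, 5], [0, 4, 6], [0, 5, 6], [1, 2, 7], [1, 3, 7],
            [2, 3, 7], [4, 5, 6]]"
  show "edge_certificate (3, 0) (1, 0) cube_points"
    unfolding cube_points_def by code_simp
  show "adjacency_lists (1, 0) cube_points = ?N"
    unfolding cube_points_def by code_simp
  show "list_all (listed_up_to_renaming
      [[[0, 1, 2], [1, 0, 2], [1, 1, 1]],
       [[1, 0, 2], [0, 1, 2], [1, 1, 1]]])
    (search (program ?N) [] [None, None, None])"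
    by code_simp
  show "list_all2 (perfect_list ?N)
    [[[0, 1, 2], [1, 0, 2], [1, 1, 1]],
     [[1, 0, 2], [0, 1, 2], [1, 1, 1]]]
    [[0, 1, 2, 2, 2, 2, 1, 0],
     [0, 0, 2, 2, 2, 2, 1, 1]]"
    by code_simp
qed

lemma octahedron_matrices:
  "perfect_coloring_matrices (edge_graph octahedron) = up_to_equivalence
     (set (map (\<lambda>M. matrix3 (map (map real) M))
       [[[0, 0, 4], [0, 0, 4], [1, 1, 2]],
        [[0, 2, 2], [2, 0, 2], [2, 2, 0]],
        [[0, 2, 2], [2, 1, 1], [2, 1, 1]]]))"
  unfolding octahedron_hull
proof (rule perfect_coloring_matrices_by_search)
  let ?N = "[[1, 2, 3, 4], [0, 3, 4, 5], [0, 3, 4, 5], [0, 1, 2, 5], [0, 1, 2, 5], [1, 2, 3, 4]]"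
  show "edge_certificate (1, 0) (0, 0) octahedron_points"
    unfolding octahedron_points_def by code_simp
  show "adjacency_lists (0, 0) octahedron_points = ?N"
    unfolding octahedron_points_def by code_simp
  show "list_all (listed_up_to_renaming
      [[[0, 0, 4], [0, 0, 4], [1, 1, 2]],
       [[0, 2, 2], [2, 0, 2], [2, 2, 0]],
       [[0, 2, 2], [2, 1, 1], [2, 1, 1]]])
    (search (program ?N) [] [None, None, None])"
    by code_simp
  show "list_all2 (perfect_list ?N)
    [[[0, 0, 4], [0, 0, 4], [1, 1, 2]],
     [[0, 2, 2], [2, 0, 2], [2, 2, 0]],
     [[0, 2, 2], [2, 1, 1], [2, 1, 1]]]
    [[0, 2, 2, 2, 2, 1],
     [0, 1, 1, 2, 2, 0],
     [0, 1, 2, 1, 2, 0]]"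
    by code_simp
qed

lemma dodecahedron_matrices:
  "perfect_coloring_matrices (edge_graph dodecahedron) = up_to_equivalence
     (set (map (\<lambda>M. matrix3 (map (map real) M))
       [[[0, 0, 3], [0, 0, 3], [1, 1, 1]],
        [[0, 3, 0], [1, 0, 2], [0, 1, 2]],
        [[1, 0, 2], [0, 1, 2], [1, 2, 0]]]))"
  unfolding dodecahedron_hull
proof (rule perfect_coloring_matrices_by_search)
  let ?N = "[[1, 2, 3], [0, 4, 5], [0, 6, 7], [0, 10, 11], [1, 7, 8], [1, 10, 12],
            [2, 11, 13], [2, 4, 9], [4, 12, 14], [7, 13, 14], [3, 5, 15], [3, 6, 16],
            [5, 8, 17], [6, 9, 18], [8, 9, 19], [10, 16, 17], [11, 15, 18], [12, 15, 19],
            [13, 16, 19], [14, 17, 18]]"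
  show "edge_certificate (3, 0) (-1, 2) dodecahedron_points"
    unfolding dodecahedron_points_def by code_simp
  show "adjacency_lists (-1, 2) dodecahedron_points = ?N"
    unfolding dodecahedron_points_def by code_simp
  show "list_all (listed_up_to_renaming
      [[[0, 0, 3], [0, 0, 3], [1, 1, 1]],
       [[0, 3, 0], [1, 0, 2], [0, 1, 2]],
       [[1, 0, 2], [0, 1, 2], [1, 2, 0]]])
    (search (program ?N) [] [None, None, None])"
    by code_simp
  show "list_all2 (perfect_list ?N)
    [[[0, 0, 3], [0, 0, 3], [1, 1, 1]],
     [[0, 3, 0], [1, 0, 2], [0, 1, 2]],
     [[1, 0, 2], [0, 1, 2], [1, 2, 0]]]
    [[0, 2, 2, 2, 1, 2, 1, 2, 2, 0, 1, 2, 0, 2, 2, 2, 0, 2, 2, 1],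
     [0, 1, 1, 1, 2, 2, 2, 2, 2, 2, 2, 2, 2, 2, 1, 2, 2, 1, 1, 0],
     [0, 0, 2, 2, 2, 2, 1, 1, 1, 1, 1, 1, 1, 2, 2, 1, 2, 2, 0, 0]]"
    by code_simp
qed

lemma icosahedron_matrices:
  "perfect_coloring_matrices (edge_graph icosahedron) = up_to_equivalence
     (set (map (\<lambda>M. matrix3 (map (map real) M))
       [[[0, 1, 4], [1, 0, 4], [1, 1, 3]],
        [[0, 2, 3], [1, 1, 3], [1, 2, 2]],
        [[1, 2, 2], [2, 1, 2], [2, 2, 1]]]))"
  unfolding icosahedron_hull
proof (rule perfect_coloring_matrices_by_search)
  let ?N = "[[1, 2, 3, 4, 5], [0, 4, 5, 6, 7], [0, 3, 4, 8, 9], [0, 2, 5, 9, 10], [0, 1, 2, 6, 8], [0, 1, 3, 7, 10],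
            [1, 4, 7, 8, 11], [1, 5, 6, 10, 11], [2, 4, 6, 9, 11], [2, 3, 8, 10, 11], [3, 5, 7, 9, 11], [6, 7, 8, 9, 10]]"
  show "edge_certificate (2, 1) (0, 1) icosahedron_points"
    unfolding icosahedron_points_def by code_simp
  show "adjacency_lists (0, 1) icosahedron_points = ?N"
    unfolding icosahedron_points_def by code_simp
  show "list_all (listed_up_to_renaming
      [[[0, 1, 4], [1, 0, 4], [1, 1, 3]],
       [[0, 2, 3], [1, 1, 3], [1, 2, 2]],
       [[1, 2, 2], [2, 1, 2], [2, 2, 1]]])
    (search (program ?N) [] [None, None, None])"
    by code_simp
  show "list_all2 (perfect_list ?N)
    [[[0, 1, 4], [1, 0, 4], [1, 1, 3]],
     [[0, 2, 3], [1, 1, 3], [1, 2, 2]],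
     [[1, 2, 2], [2, 1, 2], [2, 2, 1]]]
    [[0, 1, 2, 2, 2, 2, 2, 2, 2, 1, 2, 0],
     [0, 1, 1, 2, 2, 2, 2, 1, 2, 1, 2, 0],
     [0, 0, 1, 1, 2, 2, 1, 1, 2, 0, 2, 0]]"
    by code_simp
qed

theorem mainTheorem6:
  shows "
   perfect_coloring_matrices (edge_graph tetrahedron) = up_to_equivalence
      {matrix3 [[0, 1, 2], [1, 0, 2], [1, 1, 1]]} \<and>
   perfect_coloring_matrices (edge_graph cube) = up_to_equivalence
      {matrix3 [[0, 1, 2], [1, 0, 2], [1, 1, 1]],
       matrix3 [[1, 0, 2], [0, 1, 2], [1, 1, 1]]} \<and>
   perfect_coloring_matrices (edge_graph octahedron) = up_to_equivalence
      {matrix3 [[0, 0, 4], [0, 0, 4], [1, 1, 2]],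
       matrix3 [[0, 2, 2], [2, 0, 2], [2, 2, 0]],
       matrix3 [[0, 2, 2], [2, 1, 1], [2, 1, 1]]} \<and>
   perfect_coloring_matrices (edge_graph dodecahedron) = up_to_equivalence
      {matrix3 [[0, 0, 3], [0, 0, 3], [1, 1, 1]],
       matrix3 [[0, 3, 0], [1, 0, 2], [0, 1, 2]],
       matrix3 [[1, 0, 2], [0, 1, 2], [1, 2, 0]]} \<and>
   perfect_coloring_matrices (edge_graph icosahedron) = up_to_equivalence
      {matrix3 [[0, 1, 4], [1, 0, 4], [1, 1, 3]],
       matrix3 [[0, 2, 3], [1, 1, 3], [1, 2, 2]],
       matrix3 [[1, 2, 2], [2, 1, 2], [2, 2, 1]]}"
  using tetrahedron_matrices cube_matrices octahedron_matrices dodecahedron_matrices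
    icosahedron_matrices
  by simp

end
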